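(* If a nontrivial Puiseux monoid is transfer Krull, then it is isomorphic to $(\mathbb{N}_0, +)$.
   Context: A monoid is a commutative cancellative semigroup with identity; $M^\times$ denotes its group of units. A Puiseux monoid is an additive submonoid of $\mathbb{Q}_{\ge 0}$; it is nontrivial if it is not $\{0\}$. A monoid homomorphism $\theta \colon M \to N$ (written multiplicatively) is a transfer homomorphism if: (T1) $N = \theta(M) N^\times$ and $\theta^{-1}(N^\times) = M^\times$; (T2) whenever $\theta(a) = b_1 b_2$ with $a \in M$ and $b_1, b_2 \in N$, there exist $a_1, a_2 \in M$ such that $a = a_1 a_2$ and $\theta(a_i) = b_i$ for $i \in \{1,2\}$. For an abelian group $G$ (written additively), let $\mathcal{F}(G)$ be the (multiplicative) free abelian monoid with basis $G$, and for $X \in \mathcal{F}(G)$ let $\mathsf{v}_g(X) \in \mathbb{N}_0$ be the exponent of $g$ in $X$. For a subset $G_0 \subseteq G$, the block monoid restricted to $G_0$ is the submonoid $\mathcal{B}(G_0) = \{X \in \mathcal{F}(G) \mid \sum_{g \in G} \mathsf{v}_g(X) g = 0 \text{ and } \mathsf{v}_g(X) = 0 \text{ for all } g \notin G_0\}$ of $\mathcal{F}(G)$. A Puiseux monoid $M$ is transfer Krull if there exist an abelian group $G$, a subset $G_0$ of $G$, and a transfer homomorphism $\theta \colon M \to \mathcal{B}(G_0)$. *)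

theory Defs
  imports Complex_Main "HOL-Algebra.Coset" "HOL-Algebra.FiniteProduct" "HOL-Algebra.Divisibility" "HOL-Library.Multiset"
begin

definition nonneg_rat_monoid :: "rat monoid" where
  "nonneg_rat_monoid = \<lparr>carrier = {q. 0 \<le> q}, monoid.mult = (+), one = 0\<rparr>"

definition nat_add_monoid :: "nat monoid" where
  "nat_add_monoid = \<lparr>carrier = UNIV, monoid.mult = (+), one = 0\<rparr>"

definition puiseux_monoid :: "rat set \<Rightarrow> bool" where
  "puiseux_monoid M \<longleftrightarrow> submonoid M nonneg_rat_monoid"

definition puiseux :: "rat set \<Rightarrow> rat monoid" where
  "puiseux M = nonneg_rat_monoid\<lparr>carrier := M\<rparr>"

text \<open>Elements of the free abelian monoid with basis \<open>B\<close> are the finite multisets over \<open>B\<close>;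
  the exponent of \<open>g\<close> in \<open>X\<close> is \<open>count X g\<close>.\<close>

definition free_abelian_monoid :: "'g set \<Rightarrow> 'g multiset monoid" where
  "free_abelian_monoid B = \<lparr>carrier = {X. set_mset X \<subseteq> B}, monoid.mult = (+), one = {#}\<rparr>"

text \<open>Abelian groups are written multiplicatively here. The product ranges over the support of
  \<open>X\<close> rather than over all of \<open>carrier G\<close>, because \<open>finprod\<close> over an infinite set is \<open>\<one>\<close> by
  convention.\<close>

definition block_sum :: "('g, 'b) monoid_scheme \<Rightarrow> 'g multiset \<Rightarrow> 'g" where
  "block_sum G X = finprod G (\<lambda>g. g [^]\<^bsub>G\<^esub> count X g) (set_mset X)"

definition block_monoid :: "('g, 'b) monoid_scheme \<Rightarrow> 'g set \<Rightarrow> 'g multiset monoid" where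
  "block_monoid G G0 = (free_abelian_monoid (carrier G))
     \<lparr>carrier := {X \<in> carrier (free_abelian_monoid (carrier G)).
        block_sum G X = \<one>\<^bsub>G\<^esub> \<and> (\<forall>g\<in>carrier G. g \<notin> G0 \<longrightarrow> count X g = 0)}\<rparr>"

definition transfer_hom ::
    "('a, 'c) monoid_scheme \<Rightarrow> ('b, 'd) monoid_scheme \<Rightarrow> ('a \<Rightarrow> 'b) \<Rightarrow> bool" where
  "transfer_hom M N \<theta> \<longleftrightarrow>
     \<theta> \<in> hom M N \<and> \<theta> \<one>\<^bsub>M\<^esub> = \<one>\<^bsub>N\<^esub> \<and>
     carrier N = (\<theta> ` carrier M) <#>\<^bsub>N\<^esub> Units N \<and>
     {a \<in> carrier M. \<theta> a \<in> Units N} = Units M \<and>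
     (\<forall>a\<in>carrier M. \<forall>b1\<in>carrier N. \<forall>b2\<in>carrier N. \<theta> a = b1 \<otimes>\<^bsub>N\<^esub> b2 \<longrightarrow>
        (\<exists>a1\<in>carrier M. \<exists>a2\<in>carrier M. a = a1 \<otimes>\<^bsub>M\<^esub> a2 \<and> \<theta> a1 = b1 \<and> \<theta> a2 = b2))"

text \<open>HOL cannot quantify existentially over types, so the type of the elements of the abelian
  group is a parameter. A theorem that assumes \<open>transfer_Krull TYPE('g) M\<close> for a type variable
  \<open>'g\<close> covers abelian groups of every type.\<close>

definition transfer_Krull :: "'g itself \<Rightarrow> ('a, 'c) monoid_scheme \<Rightarrow> bool" where
  "transfer_Krull _ M \<longleftrightarrow>
     (\<exists>(G :: 'g monoid) G0 \<theta>. comm_group G \<and> G0 \<subseteq> carrier G \<and>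
        transfer_hom M (block_monoid G G0) \<theta>)"

lemma comm_monoid_cancel_puiseux:
  assumes "puiseux_monoid M"
  shows "comm_monoid_cancel (puiseux M)"
proof -
  have "M \<subseteq> {q. 0 \<le> q}" "\<And>x y. x \<in> M \<Longrightarrow> y \<in> M \<Longrightarrow> x + y \<in> M" "0 \<in> M"
    using assms submonoid.subset submonoid.m_closed submonoid.one_closed
    by (fastforce simp: puiseux_monoid_def nonneg_rat_monoid_def)+
  then show ?thesis
    by unfold_locales (auto simp: puiseux_def nonneg_rat_monoid_def Units_def)
qed

lemma block_sum_superset:
  assumes "comm_group G" "finite S" "set_mset X \<subseteq> S" "S \<subseteq> carrier G"
  shows "block_sum G X = finprod G (\<lambda>g. g [^]\<^bsub>G\<^esub> count X g) S"
proof -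
  interpret comm_group G by fact
  show ?thesis unfolding block_sum_def
    by (rule finprod_mono_neutral_cong_left) (use assms in \<open>auto simp: not_in_iff\<close>)
qed

lemma block_sum_add:
  assumes "comm_group G" "set_mset X \<subseteq> carrier G" "set_mset Y \<subseteq> carrier G"
  shows "block_sum G (X + Y) = block_sum G X \<otimes>\<^bsub>G\<^esub> block_sum G Y"
proof -
  interpret comm_group G by fact
  let ?S = "set_mset X \<union> set_mset Y"
  have S: "?S \<subseteq> carrier G" using assms by auto
  have "finprod G (\<lambda>g. g [^]\<^bsub>G\<^esub> count (X + Y) g) ?S
      = finprod G (\<lambda>g. g [^]\<^bsub>G\<^esub> count X g \<otimes>\<^bsub>G\<^esub> g [^]\<^bsub>G\<^esub> count Y g) ?S"
    by (rule finprod_cong') (use S in \<open>auto simp: nat_pow_mult\<close>)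
  also have "\<dots> = finprod G (\<lambda>g. g [^]\<^bsub>G\<^esub> count X g) ?S
      \<otimes>\<^bsub>G\<^esub> finprod G (\<lambda>g. g [^]\<^bsub>G\<^esub> count Y g) ?S"
    by (rule finprod_multf) (use S in auto)
  finally show ?thesis
    using block_sum_superset[OF assms(1) _ _ S] by auto
qed

lemma comm_monoid_cancel_block_monoid:
  assumes "comm_group G"
  shows "comm_monoid_cancel (block_monoid G G0)"
proof -
  interpret comm_group G by fact
  show ?thesis
    by unfold_locales
      (auto simp: block_monoid_def free_abelian_monoid_def block_sum_add[OF assms],
       auto simp: block_sum_def)
qed

end

theory Submission
  imports Defs
begin

text \<open>Any two elements of a Puiseux monoid \<open>M\<close> are commensurable, so every additive map from \<open>M\<close>
  to the natural numbers is multiplication by a constant (\<open>additive_proportional\<close>). For a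
  transfer homomorphism \<open>\<theta>\<close> from \<open>M\<close> to a block monoid this applies to each exponent
  \<open>b \<mapsto> count (\<theta> b) g\<close>: the blocks \<open>\<theta> b\<close> all lie on one ray, at a distance from the origin
  proportional to \<open>b\<close>. Consequently \<open>\<theta>\<close> is injective, and the positive elements of \<open>M\<close>,
  being a scaled copy of a set of natural numbers, have a least element \<open>x\<close>.

  A block monoid has only the trivial unit, so \<open>\<theta>\<close> is also onto. Moreover a block monoid is closed under those
  differences that exist in the free abelian monoid (\<open>block_monoid_diff_closed\<close>). For positive
  \<open>b \<in> M\<close> minimality of \<open>x\<close> and proportionality give \<open>\<theta> x \<subseteq># \<theta> b\<close>, hence
  \<open>\<theta> b - \<theta> x\<close> is a block, hence it is the image of an element of \<open>M\<close>, which by injectivity can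
  only be \<open>b - x\<close>. Subtracting \<open>x\<close> repeatedly shows that \<open>M\<close> consists of the natural multiples
  of \<open>x\<close>.\<close>

lemma puiseux_simps [simp]:
  "carrier (puiseux M) = M" "monoid.mult (puiseux M) = (+)" "one (puiseux M) = 0"
  by (simp_all add: puiseux_def nonneg_rat_monoid_def)

lemma puiseux_monoid_iff:
  "puiseux_monoid M \<longleftrightarrow> M \<subseteq> {0..} \<and> 0 \<in> M \<and> (\<forall>a\<in>M. \<forall>b\<in>M. a + b \<in> M)"
  by (auto simp: puiseux_monoid_def submonoid_def nonneg_rat_monoid_def)

lemma commensurable_rats:
  fixes a b :: rat
  assumes "a > 0" "b > 0"
  obtains m n :: nat where "m > 0" "n > 0" "of_nat m * a = of_nat n * b"
proof -
  obtain p q where pq: "quotient_of (b / a) = (p, q)" by (cases "quotient_of (b / a)")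
  then have q: "q > 0" and eq: "b / a = of_int p / of_int q"
    by (auto dest: quotient_of_denom_pos quotient_of_div)
  then have "p > 0"
    using assms by (metis divide_pos_pos of_int_0_less_iff zero_less_divide_iff less_asym)
  then show thesis
    using that[of "nat p" "nat q"] q eq assms by (simp add: field_simps)
qed

lemma additive_of_nat_mult:
  assumes M: "puiseux_monoid M" and "\<phi> 0 = 0"
    and add: "\<And>a b. a \<in> M \<Longrightarrow> b \<in> M \<Longrightarrow> \<phi> (a + b) = \<phi> a + (\<phi> b :: nat)"
    and a: "a \<in> M"
  shows "of_nat n * a \<in> M \<and> \<phi> (of_nat n * a) = n * \<phi> a"
proof (induction n)
  case 0
  then show ?case using assms by (simp add: puiseux_monoid_iff)
next
  case (Suc n)
  moreover have "of_nat (Suc n) * a = a + of_nat n * a" by (simp add: algebra_simps)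
  ultimately show ?case using M a add by (simp add: puiseux_monoid_iff)
qed

text \<open>Apply \<open>\<phi>\<close> to a common multiple of \<open>a\<close> and \<open>b\<close>.\<close>

lemma additive_proportional:
  assumes M: "puiseux_monoid M" and zero: "\<phi> 0 = 0"
    and add: "\<And>a b. a \<in> M \<Longrightarrow> b \<in> M \<Longrightarrow> \<phi> (a + b) = \<phi> a + (\<phi> b :: nat)"
    and a: "a \<in> M" and b: "b \<in> M"
  shows "b * of_nat (\<phi> a) = a * of_nat (\<phi> b)"
proof (cases "a = 0 \<or> b = 0")
  case True
  then show ?thesis using zero by auto
next
  case False
  then have "a > 0" "b > 0" using M a b by (auto simp: puiseux_monoid_iff order_less_le)
  then obtain m n :: nat where mn: "m > 0" "n > 0" and eq: "of_nat m * a = of_nat n * b"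
    by (rule commensurable_rats)
  have "m * \<phi> a = n * \<phi> b"
    using additive_of_nat_mult[of M \<phi>, OF M zero add] a b eq by metis
  then have "rat_of_nat m * of_nat (\<phi> a) = of_nat n * of_nat (\<phi> b)"
    by (metis of_nat_mult)
  then have "of_nat m * (b * of_nat (\<phi> a)) = (of_nat n * b) * of_nat (\<phi> b)"
    by (simp add: algebra_simps)
  also have "\<dots> = of_nat m * (a * of_nat (\<phi> b))" by (simp flip: eq)
  finally show ?thesis using mn by simp
qed

text \<open>The subtraction of \<open>x\<close> stays in \<open>M\<close>, so it stays nonnegative, and it must end at \<open>0\<close>
  because the rationals are archimedean.\<close>

lemma puiseux_monoid_eq_multiples:
  assumes M: "puiseux_monoid M" and x: "x > 0" "x \<in> M"
    and diff: "\<And>b. b \<in> M \<Longrightarrow> b > 0 \<Longrightarrow> b - x \<in> M"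
  shows "M = range (\<lambda>k. of_nat k * x)"
proof -
  have descent: "\<exists>k. b = of_nat k * x" if "b \<in> M" "b < of_nat n * x" for b n
    using that
  proof (induction n arbitrary: b)
    case 0
    then show ?case using M by (auto simp: puiseux_monoid_iff)
  next
    case (Suc n)
    show ?case
    proof (cases "b = 0")
      case True
      then show ?thesis by (intro exI[of _ 0]) simp
    next
      case False
      then have "b - x \<in> M" using Suc.prems M diff by (auto simp: puiseux_monoid_iff order_less_le)
      moreover have "b - x < of_nat n * x" using Suc.prems by (simp add: algebra_simps)
      ultimately obtain k where "b - x = of_nat k * x" using Suc.IH by blast
      then show ?thesis by (intro exI[of _ "Suc k"]) (simp add: algebra_simps)
    qed
  qed
  have "of_nat k * x \<in> M" for k
    by (induction k) (use M x in \<open>auto simp: puiseux_monoid_iff algebra_simps\<close>)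
  then show ?thesis
    using descent ex_less_of_nat_mult[OF x(1)] by blast
qed

lemma puiseux_multiples_iso:
  assumes "x > 0"
  shows "puiseux (range (\<lambda>k. of_nat k * x)) \<cong> nat_add_monoid"
proof -
  define f where "f k = of_nat k * x" for k :: nat
  have inj: "inj f" using assms by (auto simp: f_def inj_def)
  have add: "f (j + k) = f j + f k" for j k by (simp add: f_def algebra_simps)
  have "inv_into UNIV f \<in> iso (puiseux (range f)) nat_add_monoid"
    using inj_imp_bij_betw_inv[OF inj, of UNIV]
    by (auto simp: iso_def hom_def nat_add_monoid_def inj simp flip: add)
  then show ?thesis by (auto simp: is_iso_def f_def)
qed

lemma block_monoid_simps [simp]:
  "monoid.mult (block_monoid G G0) = (+)" "one (block_monoid G G0) = {#}"
  by (simp_all add: block_monoid_def free_abelian_monoid_def)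

text \<open>The sum of \<open>Y - X\<close> is the quotient of two trivial sums in \<open>G\<close>.\<close>

lemma block_monoid_diff_closed:
  assumes "comm_group G"
    and X: "X \<in> carrier (block_monoid G G0)" and Y: "Y \<in> carrier (block_monoid G G0)"
    and "X \<subseteq># Y"
  shows "Y - X \<in> carrier (block_monoid G G0)"
proof -
  interpret comm_group G by fact
  have "set_mset X \<subseteq> carrier G" "set_mset Y \<subseteq> carrier G"
    using X Y by (auto simp: block_monoid_def free_abelian_monoid_def)
  then have sub: "set_mset X \<subseteq> carrier G" "set_mset (Y - X) \<subseteq> carrier G"
    by (auto dest: in_diffD)
  have "block_sum G (Y - X) \<in> carrier G"
    unfolding block_sum_def using sub by (intro finprod_closed) auto
  moreover have "block_sum G Y = block_sum G (Y - X) \<otimes>\<^bsub>G\<^esub> block_sum G X"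
    using block_sum_add[OF assms(1) sub(2,1)] assms(4) by simp
  ultimately have "block_sum G (Y - X) = \<one>\<^bsub>G\<^esub>"
    using X Y by (simp add: block_monoid_def)
  then show ?thesis
    using Y sub by (simp add: block_monoid_def free_abelian_monoid_def)
qed

lemma Units_block_monoid:
  assumes "comm_group G"
  shows "Units (block_monoid G G0) = {{#}}"
proof -
  interpret comm_monoid_cancel "block_monoid G G0"
    by (rule comm_monoid_cancel_block_monoid) fact
  show ?thesis using one_closed by (auto simp: Units_def)
qed

text \<open>The least positive element is found by minimising one nonzero exponent.\<close>

lemma transfer_Krull_puiseux_eq_multiples:
  assumes M: "puiseux_monoid M" "M \<noteq> {0}" and G: "comm_group G"
    and th: "transfer_hom (puiseux M) (block_monoid G G0) \<theta>"
  obtains x where "x > 0" "M = range (\<lambda>k. of_nat k * x)"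
proof -
  let ?B = "carrier (block_monoid G G0)"
  have zero: "\<theta> 0 = {#}"
    and add: "\<And>a b. a \<in> M \<Longrightarrow> b \<in> M \<Longrightarrow> \<theta> (a + b) = \<theta> a + \<theta> b"
    and surj: "?B = \<theta> ` M"
    using th by (auto simp: transfer_hom_def hom_def Units_block_monoid[OF G] set_mult_def)
  have "Units (puiseux M) \<subseteq> {0}"
    using M(1) by (auto simp: Units_def puiseux_monoid_iff add_nonneg_eq_0_iff subset_iff)
  then have kernel: "a = 0" if "a \<in> M" "\<theta> a = {#}" for a
    using that th by (auto simp: transfer_hom_def Units_block_monoid[OF G])
  have ray: "b * of_nat (count (\<theta> a) g) = a * of_nat (count (\<theta> b) g)"
    if "a \<in> M" "b \<in> M" for a b g
    by (rule additive_proportional[OF M(1) _ _ that]) (simp_all add: zero add)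

  obtain a where a: "a \<in> M" "a \<noteq> 0" using M by (auto simp: puiseux_monoid_iff)
  then obtain g where g: "count (\<theta> a) g \<noteq> 0"
    using kernel by (metis multiset_nonemptyE count_eq_zero_iff)
  have pos: "count (\<theta> b) g > 0" if "b \<in> M" "b \<noteq> 0" for b
    using ray[OF a(1) that(1), of g] g that by (intro gr0I) simp
  have inj: "b = c" if "b \<in> M" "c \<in> M" "\<theta> b = \<theta> c" for b c
  proof -
    have "b * of_nat (count (\<theta> a) g) = c * of_nat (count (\<theta> a) g)"
      using ray[OF a(1) that(1), of g] ray[OF a(1) that(2), of g] that(3) by argo
    then show ?thesis using g by (simp del: count_eq_zero_iff)
  qed

  obtain x where x: "x \<in> M" "x \<noteq> 0"
    and least: "\<And>b. b \<in> M \<Longrightarrow> b \<noteq> 0 \<Longrightarrow> count (\<theta> x) g \<le> count (\<theta> b) g"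
    using ex_has_least_nat[of "\<lambda>b. b \<in> M \<and> b \<noteq> 0" a "\<lambda>b. count (\<theta> b) g"] a by blast
  have x_pos: "x > 0" using M x by (auto simp: puiseux_monoid_iff order_less_le)
  have "b - x \<in> M" if b: "b \<in> M" "b > 0" for b
  proof -
    have "x * of_nat (count (\<theta> b) g) \<le> b * of_nat (count (\<theta> b) g)"
      using ray[OF x(1) b(1), of g] least[OF b(1)] b
      by (metis less_irrefl mult_left_mono of_nat_mono order_less_imp_le)
    then have "x \<le> b" using pos[OF b(1)] b by simp
    \<comment> \<open>The exponents at every other group element grow in the same ratio \<open>b / x\<close> as the one at \<open>g\<close>.\<close>
    have "count (\<theta> x) h \<le> count (\<theta> b) h" for h
    proof -
      have "x * rat_of_nat (count (\<theta> x) h) \<le> b * of_nat (count (\<theta> x) h)"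
        using \<open>x \<le> b\<close> by (intro mult_right_mono) auto
      then show ?thesis using ray[OF x(1) b(1), of h] x_pos by simp
    qed
    then have le: "\<theta> x \<subseteq># \<theta> b" by (simp add: subseteq_mset_def)
    then have "\<theta> b - \<theta> x \<in> ?B"
      using block_monoid_diff_closed[OF G, of "\<theta> x" G0 "\<theta> b"] surj x b by auto
    then obtain c where c: "c \<in> M" "\<theta> c = \<theta> b - \<theta> x" using surj by auto
    then have "\<theta> (c + x) = \<theta> b" using le x by (simp add: add)
    then have "c + x = b" using inj M(1) c x b by (auto simp: puiseux_monoid_iff)
    then show ?thesis using c by auto
  qed
  then show thesis using that puiseux_monoid_eq_multiples[OF M(1) x_pos x(1)] x_pos by blast
qed

theorem theorem6p6:
  fixes M :: "rat set"
  assumes "puiseux_monoid M"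
    and "M \<noteq> {0}"
    and "transfer_Krull TYPE('g) (puiseux M)"
  shows "puiseux M \<cong> nat_add_monoid"
proof -
  obtain G :: "'g monoid" and G0 \<theta> where "comm_group G"
    and "transfer_hom (puiseux M) (block_monoid G G0) \<theta>"
    using assms(3) by (auto simp: transfer_Krull_def)
  then obtain x where "x > 0" "M = range (\<lambda>k. of_nat k * x)"
    using transfer_Krull_puiseux_eq_multiples[OF assms(1,2)] by metis
  then show ?thesis using puiseux_multiples_iso by blast
qed

end
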